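(* Let $k\ge 2$ be a fixed integer. Then for every $d_0$ there exists an integer $d\ge d_0$ such that for every $N_0$ there exist an integer $N\ge N_0$ and a centrally symmetric $d$-dimensional polytope with $N$ vertices and at least $$\left(1-k^2\left(2^{-3/(20k^2 2^k)}\right)^d\right)\binom{N}{k}$$ faces of dimension $k-1$.
   Context: A polytope $P$ is centrally symmetric if $P=-P$. *)

theory Defs
  imports "HOL-Analysis.Analysis" "HOL-Analysis.Finite_Function_Topology"
begin

text \<open>
  The dimension of the polytope is quantified inside the statement, so the ambient space cannot be
  a type such as \<open>real ^ 'n\<close>. Polytopes live instead in \<open>nat \<Rightarrow>\<^sub>0 real\<close>, the real vector space of
  finitely supported sequences, i.e. the union of the coordinate spaces
  $\mathbf{R}^0 \subset \mathbf{R}^1 \subset \mathbf{R}^2 \subset \cdots$; every finite set of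
  points, hence every polytope, lies in one of them. The library notions \<open>polytope\<close>, \<open>face_of\<close> and
  \<open>extreme_point_of\<close> are available for every real vector space.
\<close>

text \<open>
  The library's \<open>aff_dim\<close> is restricted to the class \<open>euclidean_space\<close>; this is the same definition
  over an arbitrary real vector space. It is meaningful for sets with a finite-dimensional affine
  hull, in particular for polytopes and their faces; the empty set has dimension \<open>-1\<close>.
\<close>

definition affine_dim :: "'a::real_vector set \<Rightarrow> int"
  where "affine_dim V =
    (SOME d :: int.
      \<exists>B. affine hull B = affine hull V \<and> \<not> affine_dependent B \<and> of_nat (card B) = d + 1)"

lemma affine_dim_eq_aff_dim: "affine_dim V = aff_dim V"
  for V :: "'a::euclidean_space set"
  by (simp add: affine_dim_def aff_dim_def)

definition centrally_symmetric :: "'a::real_vector set \<Rightarrow> bool"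
  where "centrally_symmetric P \<longleftrightarrow> P = uminus ` P"

definition vertices :: "'a::real_vector set \<Rightarrow> 'a set"
  where "vertices P = {v. v extreme_point_of P}"

definition faces_of_dim :: "int \<Rightarrow> 'a::real_vector set \<Rightarrow> 'a set set"
  where "faces_of_dim j P = {F. F face_of P \<and> affine_dim F = j}"

end

theory Submission
  imports Defs
begin

text \<open>
  The polytope is the convex hull of the points \<open>w \<otimes> u\<close> in $\mathbf{R}^m \otimes \mathbf{C}$, where \<open>w\<close>
  runs over a system \<open>W\<close> of vectors of length \<open>sqrt m\<close> with pairwise inner products at most
  \<open>m / (2 k)\<close> in absolute value, and \<open>u\<close> over the \<open>4 j\<close>-th roots of unity. The Gram matrix of at most
  \<open>k\<close> vectors of \<open>W\<close> is diagonally dominant, so for distinct \<open>w\<^sub>1, \<dots>, w\<^sub>k\<close> and unit numbers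
  \<open>u\<^sub>1, \<dots>, u\<^sub>k\<close> there is a combination $h$ of the \<open>w\<^sub>i\<close> with complex coefficients and
  \<open>\<langle>h, w\<^sub>i\<rangle> = u\<^sub>i\<close>, and it satisfies \<open>\<bar>\<langle>h, w\<rangle>\<bar> < 1\<close> for all other \<open>w\<close> in \<open>W\<close>. The functional
  \<open>w \<otimes> u \<mapsto> Re (cnj u * \<langle>h, w\<rangle>)\<close> then attains its maximum 1 exactly at the points \<open>w\<^sub>i \<otimes> u\<^sub>i\<close>. Hence a
  set of \<open>k\<close> vertices spans a face unless two of them share \<open>w\<close>, which happens for a fraction of at
  most \<open>k\<^sup>2 / (2 |W|)\<close> of all \<open>k\<close>-sets, for every \<open>j\<close>. A maximal code in \<open>{-1, 1}\<^sup>m\<close> together with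
  the Chernoff bound gives \<open>2 |W| \<ge> exp (m / (8 k\<^sup>2))\<close>, which beats the required rate in dimension
  \<open>2 m\<close>.
\<close>

section \<open>Faces and dimension of polytopes in real vector spaces\<close>

text \<open>Translating a point of each set to the origin turns both sets into bases of linear
  subspaces. The base points differ by a vector of the first span, so the two spans coincide, and
  the cardinality bound for independent sets applies in both directions. Finiteness of
  \<open>B'\<close> is part of the claim because \<open>card\<close> of an infinite set is
  0.\<close>

lemma affine_independent_card_eq:
  fixes B B' :: "'a::real_vector set"
  assumes "finite B" "\<not> affine_dependent B" "\<not> affine_dependent B'" "affine hull B = affine hull B'"
  shows "finite B' \<and> card B' = card B"
proof (cases "B = {}")
  case True
  with assms show ?thesis by simp
next
  case False
  then obtain a a' where a: "a \<in> B" and a': "a' \<in> B'"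
    using assms(4) by (metis affine_hull_eq_empty ex_in_conv)
  define D D' where "D = (\<lambda>x. -a + x) ` (B - {a})" and "D' = (\<lambda>x. -a' + x) ` (B' - {a'})"
  have ind: "independent D" "independent D'"
    using affine_dependent_iff_dependent[of a "B - {a}"] affine_dependent_iff_dependent[of a' "B' - {a'}"]
      a a' assms(2,3) by (simp_all add: D_def D'_def insert_absorb)
  have "affine hull B = (+) a ` span D"
    using affine_hull_insert_span_gen[of a "B - {a}"] a
    by (simp add: D_def insert_absorb)
  moreover have "affine hull B' = (+) a' ` span D'"
    using affine_hull_insert_span_gen[of a' "B' - {a'}"] a'
    by (simp add: D'_def insert_absorb)
  ultimately have eq: "(+) a ` span D = (+) a' ` span D'"
    using assms(4) by simp
  have "a' \<in> (+) a ` span D"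
    unfolding eq by (auto simp: image_iff span_zero)
  then have aa: "a' - a \<in> span D" by auto
  have sp: "span D = span D'"
  proof (intro set_eqI iffI)
    fix x assume x: "x \<in> span D"
    then have "a' + x = a + ((a' - a) + x)" "(a' - a) + x \<in> span D"
      using aa by (auto intro: span_add)
    then have "a' + x \<in> (+) a' ` span D'" unfolding eq[symmetric] by blast
    then show "x \<in> span D'" by auto
  next
    fix x assume "x \<in> span D'"
    then have "a' + x \<in> (+) a ` span D" unfolding eq by blast
    then obtain y where "y \<in> span D" "a' + x = a + y" by blast
    then have "x = y - (a' - a)" by (simp add: algebra_simps)
    then show "x \<in> span D" using aa \<open>y \<in> span D\<close> by (simp add: span_diff)
  qed
  have fD: "finite D" using assms(1) by (simp add: D_def)
  have 1: "finite D' \<and> card D' \<le> card D"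
    by (rule independent_span_bound[OF fD ind(2)]) (simp add: sp span_superset)
  moreover have "card D \<le> card D'"
    by (rule conjunct2[OF independent_span_bound[OF _ ind(1)]]) (use 1 sp in \<open>auto intro: span_base\<close>)
  moreover have "finite (B' - {a'})"
    by (rule finite_imageD[of "\<lambda>x. -a' + x"]) (use 1 in \<open>auto simp: D'_def\<close>)
  moreover have "card D = card (B - {a})" "card D' = card (B' - {a'})"
    unfolding D_def D'_def by (auto intro!: card_image)
  ultimately have "finite B'" "card (B - {a}) = card (B' - {a'})"
    by auto
  then show ?thesis
    using card_Suc_Diff1[OF assms(1) a] card_Suc_Diff1[OF _ a'] by simp
qed

text \<open>Makes the choice in \<open>affine_dim\<close> determinate: one finite affine basis of
  the hull fixes the value.\<close>

lemma affine_dim_eqI: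
  fixes V :: "'a::real_vector set"
  assumes "finite B" "\<not> affine_dependent B" "affine hull B = affine hull V"
  shows "affine_dim V = int (card B) - 1"
  unfolding affine_dim_def
proof (rule some_equality)
  show "\<exists>B'. affine hull B' = affine hull V \<and> \<not> affine_dependent B' \<and>
      of_nat (card B') = int (card B) - 1 + 1"
    using assms by auto
next
  fix d :: int
  assume "\<exists>B'. affine hull B' = affine hull V \<and> \<not> affine_dependent B' \<and> of_nat (card B') = d + 1"
  then obtain B' where "affine hull B' = affine hull V" "\<not> affine_dependent B'" "int (card B') = d + 1"
    by auto
  then show "d = int (card B) - 1"
    using affine_independent_card_eq[OF assms(1,2), of B'] assms(3) by simp
qed

text \<open>Every point of \<open>S\<close> with positive weight in a convex combination for
  \<open>x\<close> in \<open>T\<close> lies in \<open>T\<close>: unless it is \<open>x\<close>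
  itself, it is an endpoint of a segment in the hull with \<open>x\<close> in its interior.\<close>

lemma face_of_convex_hull_eq:
  fixes S :: "'a::real_vector set"
  assumes "finite S" "T face_of convex hull S"
  shows "T = convex hull (T \<inter> S)"
proof
  show "convex hull (T \<inter> S) \<subseteq> T"
    using assms(2) by (simp add: face_of_imp_convex hull_minimal)
  show "T \<subseteq> convex hull (T \<inter> S)"
  proof
    fix x assume x: "x \<in> T"
    then have "x \<in> convex hull S" using assms(2) face_of_imp_subset by blast
    then obtain c where c: "\<And>v. v \<in> S \<Longrightarrow> 0 \<le> c v" "sum c S = 1" "(\<Sum>v\<in>S. c v *\<^sub>R v) = x"
      unfolding convex_hull_finite[OF assms(1)] by auto
    have inT: "v \<in> T" if v: "v \<in> S" "c v \<noteq> 0" for v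
    proof (cases "v = x")
      case True
      then show ?thesis using x by simp
    next
      case False
      have s1: "sum c (S - {v}) = 1 - c v"
        using c(2) assms(1) v by (simp add: sum_diff1)
      have xs: "x = c v *\<^sub>R v + (\<Sum>w\<in>S - {v}. c w *\<^sub>R w)"
        unfolding c(3)[symmetric] by (rule sum.remove[OF assms(1) v(1)])
      have "c v < 1"
      proof (rule ccontr)
        assume "\<not> c v < 1"
        then have "sum c (S - {v}) = 0"
          using s1 sum_nonneg[of "S - {v}" c] c(1) by force
        then have "\<forall>w\<in>S - {v}. c w = 0"
          using sum_nonneg_eq_0_iff[of "S - {v}" c] c(1) assms(1) by blast
        moreover have "c v = 1"
          using s1 \<open>sum c (S - {v}) = 0\<close> by linarith
        ultimately have "x = v" using xs by simp
        with False show False by simp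
      qed
      \<comment> \<open>The other endpoint of the segment: the remaining weights, renormalised to
        sum 1.\<close>
      define y where "y = (\<Sum>w\<in>S - {v}. (c w / (1 - c v)) *\<^sub>R w)"
      have "y \<in> convex hull S"
        unfolding y_def
      proof (rule convex_sum)
        show "(\<Sum>w\<in>S - {v}. c w / (1 - c v)) = 1"
          using s1 \<open>c v < 1\<close> by (simp flip: sum_divide_distrib)
      qed (use assms(1) c(1) \<open>c v < 1\<close> in \<open>auto intro: hull_inc\<close>)
      have xy: "x = c v *\<^sub>R v + (1 - c v) *\<^sub>R y"
        using xs \<open>c v < 1\<close> by (simp add: y_def scaleR_sum_right)
      then have "v \<noteq> y" using False by (auto simp flip: scaleR_add_left)
      then have "x \<in> open_segment v y"
        unfolding in_segment using xy \<open>c v < 1\<close> c(1)[OF v(1)] v(2)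
        by (intro conjI exI[of _ "1 - c v"]) auto
      then show ?thesis
        using face_ofD[OF assms(2) _ _ \<open>y \<in> convex hull S\<close> x] v(1) by (metis hull_inc)
    qed
    have "x = (\<Sum>v\<in>T \<inter> S. c v *\<^sub>R v)"
      unfolding c(3)[symmetric]
      by (rule sum.mono_neutral_right) (use assms(1) inT in auto)
    moreover have "sum c (T \<inter> S) = 1"
      unfolding c(2)[symmetric]
      by (rule sum.mono_neutral_left) (use assms(1) inT in auto)
    moreover have "(\<Sum>v\<in>T \<inter> S. c v *\<^sub>R v) \<in> convex hull (T \<inter> S)" if "sum c (T \<inter> S) = 1"
      by (rule convex_sum[OF _ convex_convex_hull that]) (use assms(1) c(1) in \<open>auto intro: hull_inc\<close>)
    ultimately show "x \<in> convex hull (T \<inter> S)"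
      by simp
  qed
qed

text \<open>A face is determined by the points of \<open>S\<close> in it. Finiteness matters because
  lower bounds on \<open>card\<close> by an injection hold only for a finite target.\<close>

lemma finite_faces_of_convex_hull:
  fixes S :: "'a::real_vector set"
  assumes "finite S"
  shows "finite {T. T face_of convex hull S}"
proof (rule finite_subset)
  show "{T. T face_of convex hull S} \<subseteq> (hull) convex ` Pow S"
    using face_of_convex_hull_eq[OF assms] by blast
qed (use assms in simp)

section \<open>Subsets cut out by a linear functional\<close>

definition supported :: "'a::real_vector set \<Rightarrow> 'a set \<Rightarrow> bool"
  where "supported X S \<longleftrightarrow>
    (\<exists>f::'a \<Rightarrow> real. linear f \<and> (\<forall>x\<in>S. f x = 1) \<and> (\<forall>x\<in>X - S. f x < 1))"

lemma affine_hull_level: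
  fixes f :: "'a::real_vector \<Rightarrow> real"
  assumes "linear f" "\<forall>x\<in>S. f x = 1"
  shows "affine hull S \<subseteq> {x. f x = 1}"
proof (rule hull_minimal)
  show "affine {x. f x = 1}"
    unfolding affine_def using assms(1) by (simp add: linear_add linear_scale)
qed (use assms in auto)

lemma convex_hull_sublevel:
  fixes f :: "'a::real_vector \<Rightarrow> real"
  assumes "linear f" "\<forall>x\<in>S. f x < 1"
  shows "convex hull S \<subseteq> {x. f x < 1}"
proof (rule hull_minimal)
  show "convex {x. f x < 1}"
    unfolding convex_alt using assms(1)
    by (auto simp: linear_add linear_scale intro!: convex_bound_lt)
qed (use assms in auto)

text \<open>The functional separates the affine hull of \<open>S\<close> (level 1) from the convex
  hull of the other points (below 1), and such disjointness forces a face.\<close>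

lemma supported_face:
  assumes "finite X" "S \<subseteq> X" "supported X S"
  shows "convex hull S face_of convex hull X"
proof -
  obtain f :: "'a \<Rightarrow> real" where "linear f" "\<forall>x\<in>S. f x = 1" "\<forall>x\<in>X - S. f x < 1"
    using assms(3) unfolding supported_def by blast
  then have "affine hull S \<subseteq> {x. f x = 1}" "convex hull (X - S) \<subseteq> {x. f x < 1}"
    using affine_hull_level convex_hull_sublevel by blast+
  then show ?thesis
    using assms(1,2) by (intro face_of_convex_hulls) fastforce+
qed

lemma supported_Int_hull:
  assumes "S \<subseteq> X" "supported X S"
  shows "convex hull S \<inter> X = S"
proof -
  obtain f :: "'a \<Rightarrow> real" where f: "linear f" "\<forall>x\<in>S. f x = 1" "\<forall>x\<in>X - S. f x < 1"
    using assms(2) unfolding supported_def by blast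
  then have "convex hull S \<subseteq> {x. f x = 1}"
    using affine_hull_level convex_hull_subset_affine_hull by blast
  then show ?thesis
    using f assms(1) hull_subset[of S convex] by force
qed

text \<open>If \<open>p\<close> lay in the affine hull of \<open>S - {p}\<close>, the functional
  supporting \<open>S - {p}\<close> would equal 1 at \<open>p\<close>, although it is strictly
  smaller there.\<close>

lemma supported_independent:
  assumes "S \<subseteq> X" "\<And>p. p \<in> S \<Longrightarrow> supported X (S - {p})"
  shows "\<not> affine_dependent S"
proof
  assume "affine_dependent S"
  then obtain p where p: "p \<in> S" "p \<in> affine hull (S - {p})"
    unfolding affine_dependent_def by blast
  obtain f :: "'a \<Rightarrow> real" where f: "linear f" "\<forall>x\<in>S - {p}. f x = 1" "\<forall>x\<in>X - (S - {p}). f x < 1"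
    using assms(2)[OF p(1)] unfolding supported_def by blast
  then have "f p = 1" using p affine_hull_level by blast
  moreover have "f p < 1" using f p assms(1) by blast
  ultimately show False by simp
qed

lemma vertices_supported:
  assumes "finite X" "\<And>x. x \<in> X \<Longrightarrow> supported X {x}"
  shows "vertices (convex hull X) = X"
proof -
  have "x extreme_point_of convex hull X" if "x \<in> X" for x
    using supported_face[OF assms(1) _ assms(2)[OF that]] that by (simp add: face_of_singleton)
  then show ?thesis
    unfolding vertices_def using extreme_points_of_convex_hull by blast
qed

text \<open>Since all subsets of \<open>S\<close> are supported, the hull of \<open>S\<close> is a
  face and \<open>S\<close> is affinely independent, so the face has dimension \<open>k - 1\<close>.
  Intersecting with \<open>X\<close> recovers \<open>S\<close>, hence different sets give different
  faces.\<close>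

lemma card_faces_of_dim_ge:
  assumes "finite X" and sub: "\<And>S. S \<in> \<G> \<Longrightarrow> S \<subseteq> X \<and> card S = k"
    and sup: "\<And>S T. S \<in> \<G> \<Longrightarrow> T \<subseteq> S \<Longrightarrow> supported X T"
  shows "card \<G> \<le> card (faces_of_dim (int k - 1) (convex hull X))"
proof (rule card_inj_on_le)
  show "inj_on ((hull) convex) \<G>"
    by (rule inj_on_inverseI[where g = "\<lambda>F. F \<inter> X"]) (use sub sup supported_Int_hull in blast)
  show "finite (faces_of_dim (int k - 1) (convex hull X))"
    unfolding faces_of_dim_def using finite_faces_of_convex_hull[OF assms(1)] by simp
  show "(hull) convex ` \<G> \<subseteq> faces_of_dim (int k - 1) (convex hull X)"
  proof (rule image_subsetI)
    fix S assume S: "S \<in> \<G>"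
    then have "finite S" using sub assms(1) finite_subset by blast
    moreover have "\<not> affine_dependent S"
      by (rule supported_independent[of _ X]) (use S sub sup in auto)
    ultimately have "affine_dim (convex hull S) = int k - 1"
      using affine_dim_eqI[of S "convex hull S"] sub[OF S] by simp
    then show "convex hull S \<in> faces_of_dim (int k - 1) (convex hull X)"
      unfolding faces_of_dim_def using supported_face[OF assms(1)] sub[OF S] sup[OF S] by simp
  qed
qed

section \<open>Interpolation for incoherent systems\<close>

text \<open>Gaussian elimination in the form of an induction. Requiring a trivial kernel for every
  principal submatrix lets the hypothesis pass to smaller index sets.\<close>

lemma solvable_if_principal_minors_nondegenerate:
  fixes G :: "'i \<Rightarrow> 'i \<Rightarrow> 'a::field"
  assumes "finite A"
    and "\<And>S c. S \<subseteq> A \<Longrightarrow> (\<And>s. s \<in> S \<Longrightarrow> (\<Sum>r\<in>S. c r * G r s) = 0) \<Longrightarrow> (\<And>r. r \<in> S \<Longrightarrow> c r = 0)"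
  shows "\<exists>c. \<forall>s\<in>A. (\<Sum>r\<in>A. c r * G r s) = b s"
  using assms
proof (induction A arbitrary: b rule: finite_induct)
  case empty
  then show ?case by simp
next
  case (insert x A)
  have IH: "\<exists>c. \<forall>s\<in>A. (\<Sum>r\<in>A. c r * G r s) = b s" for b
  proof (rule insert.IH)
    fix S c r
    assume "S \<subseteq> A" "\<And>s. s \<in> S \<Longrightarrow> (\<Sum>r\<in>S. c r * G r s) = 0" "r \<in> S"
    then show "c r = 0" by (intro insert.prems[of S c r]) auto
  qed
  obtain p where p: "\<forall>s\<in>A. (\<Sum>r\<in>A. p r * G r s) = - G x s"
    using IH[of "\<lambda>s. - G x s"] by blast
  obtain a where a: "\<forall>s\<in>A. (\<Sum>r\<in>A. a r * G r s) = b s"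
    using IH[of b] by blast
  have upd: "(\<Sum>r\<in>insert x A. (f(x := t)) r * G r s) = t * G x s + (\<Sum>r\<in>A. f r * G r s)" for f t s
    using insert.hyps by (auto intro!: sum.cong)
  \<comment> \<open>\<open>y\<close> satisfies all old equations with right-hand side 0, so adding a
    multiple of it changes only the equation at \<open>x\<close>. Its value \<open>D\<close> there
    is the Schur complement; \<open>D = 0\<close> would make \<open>y\<close> a nonzero kernel
    vector.\<close>
  define y where "y = p(x := 1)"
  have y0: "(\<Sum>r\<in>insert x A. y r * G r s) = 0" if "s \<in> A" for s
    unfolding y_def upd using p that by simp
  define D where "D = (\<Sum>r\<in>insert x A. y r * G r x)"
  have "D \<noteq> 0"
  proof
    assume "D = 0"
    then have "y x = 0"
      using y0 by (intro insert.prems[of "insert x A" y x]) (auto simp: D_def)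
    then show False by (simp add: y_def)
  qed
  define e where "e = (b x - (\<Sum>r\<in>A. a r * G r x)) / D"
  define c where "c r = (a(x := 0)) r + e * y r" for r
  have "(\<Sum>r\<in>insert x A. c r * G r s) = (\<Sum>r\<in>A. a r * G r s) + e * (\<Sum>r\<in>insert x A. y r * G r s)" for s
    using upd[of a 0 s] by (simp only: c_def distrib_right sum.distrib sum_distrib_left mult.assoc) simp
  then have "\<forall>s\<in>insert x A. (\<Sum>r\<in>insert x A. c r * G r s) = b s"
    using a y0 \<open>D \<noteq> 0\<close> by (auto simp: e_def simp flip: D_def)
  then show ?case by blast
qed

text \<open>Diagonal dominance: in the equation at an index \<open>s\<close> where
  \<open>norm (c s) = M\<close> is largest, the off-diagonal terms contribute at most
  \<open>(k - 1) / (2 * k) * M\<close>, which leaves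
  \<open>M * (k + 1) / (2 * k) \<le> t\<close>.\<close>

lemma coherent_coefficient_bound:
  fixes G :: "'i \<Rightarrow> 'i \<Rightarrow> real" and c :: "'i \<Rightarrow> complex"
  assumes "finite A" "card A \<le> k"
    and diag: "\<And>r. r \<in> A \<Longrightarrow> G r r = 1"
    and off: "\<And>r s. r \<in> A \<Longrightarrow> s \<in> A \<Longrightarrow> r \<noteq> s \<Longrightarrow> \<bar>G r s\<bar> \<le> 1 / (2 * real k)"
    and bound: "\<And>s. s \<in> A \<Longrightarrow> norm (\<Sum>r\<in>A. c r * G r s) \<le> t"
    and "q \<in> A"
  shows "norm (c q) \<le> 2 * real k / (real k + 1) * t"
proof -
  define M where "M = Max ((\<lambda>r. norm (c r)) ` A)"
  have le: "norm (c r) \<le> M" if "r \<in> A" for r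
    using that assms(1) by (simp add: M_def)
  have "M \<in> (\<lambda>r. norm (c r)) ` A"
    unfolding M_def using assms(1,6) by (intro Max_in) auto
  then obtain s where s: "s \<in> A" "M = norm (c s)" by blast
  have "k > 0" using assms(1,2,6) by (metis card_gt_0_iff empty_iff gr0I leD)
  have "M \<ge> 0" by (simp add: s)
  have "norm (\<Sum>r\<in>A - {s}. c r * G r s) \<le> (\<Sum>r\<in>A - {s}. M * (1 / (2 * real k)))"
  proof (rule sum_norm_le)
    fix r assume "r \<in> A - {s}"
    then have "norm (c r) \<le> M" "\<bar>G r s\<bar> \<le> 1 / (2 * real k)"
      using le off[of r s] s(1) by auto
    then have "norm (c r) * \<bar>G r s\<bar> \<le> M * (1 / (2 * real k))"
      using \<open>M \<ge> 0\<close> by (intro mult_mono) auto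
    then show "norm (c r * G r s) \<le> M * (1 / (2 * real k))" by (simp add: norm_mult)
  qed
  also have "\<dots> = real (card A - 1) * (M * (1 / (2 * real k)))"
    using s assms(1) by simp
  also have "\<dots> \<le> (real k - 1) * (M * (1 / (2 * real k)))"
    using assms(2) \<open>M \<ge> 0\<close> \<open>k > 0\<close> by (intro mult_right_mono) auto
  finally have *: "norm (\<Sum>r\<in>A - {s}. c r * G r s) \<le> (real k - 1) * (M * (1 / (2 * real k)))" .
  have "c s = (\<Sum>r\<in>A. c r * G r s) - (\<Sum>r\<in>A - {s}. c r * G r s)"
    using sum.remove[OF assms(1) s(1), of "\<lambda>r. c r * G r s"] diag[OF s(1)] by simp
  then have "M \<le> norm (\<Sum>r\<in>A. c r * G r s) + norm (\<Sum>r\<in>A - {s}. c r * G r s)"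
    unfolding s(2) by (metis norm_triangle_ineq4)
  then have "M \<le> t + (real k - 1) * (M * (1 / (2 * real k)))"
    using bound[OF s(1)] * by linarith
  then have "M * (real k + 1) \<le> 2 * real k * t"
    using \<open>k > 0\<close> by (simp add: field_simps)
  then have "M \<le> 2 * real k / (real k + 1) * t"
    by (simp add: field_simps)
  then show ?thesis using le[OF assms(6)] by linarith
qed

text \<open>The coefficient bound is used twice: with \<open>t = 0\<close> it gives trivial kernels
  and hence solvability, with \<open>t = 1\<close> it bounds the solution. Outside \<open>A\<close>
  the sum is then at most \<open>k * (2 * k / (k + 1)) / (2 * k) = k / (k + 1)\<close>.\<close>

lemma coherent_interpolation:
  fixes G :: "'i \<Rightarrow> 'i \<Rightarrow> real" and b :: "'i \<Rightarrow> complex"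
  assumes "finite A" "card A \<le> k" "A \<subseteq> W"
    and diag: "\<And>r. r \<in> W \<Longrightarrow> G r r = 1"
    and off: "\<And>r s. r \<in> W \<Longrightarrow> s \<in> W \<Longrightarrow> r \<noteq> s \<Longrightarrow> \<bar>G r s\<bar> \<le> 1 / (2 * real k)"
    and b: "\<And>r. r \<in> A \<Longrightarrow> norm (b r) = 1"
  obtains c :: "'i \<Rightarrow> complex"
  where "\<And>s. s \<in> A \<Longrightarrow> (\<Sum>r\<in>A. c r * G r s) = b s"
    and "\<And>w. w \<in> W - A \<Longrightarrow> norm (\<Sum>r\<in>A. c r * G r w) < 1"
proof -
  have "\<exists>c. \<forall>s\<in>A. (\<Sum>r\<in>A. c r * complex_of_real (G r s)) = b s"
  proof (rule solvable_if_principal_minors_nondegenerate[OF assms(1)])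
    fix S c r
    assume S: "S \<subseteq> A" "\<And>s. s \<in> S \<Longrightarrow> (\<Sum>r\<in>S. c r * complex_of_real (G r s)) = 0" and "r \<in> S"
    have "card S \<le> k" using S(1) assms(1,2) card_mono le_trans by blast
    then have "norm (c r) \<le> 2 * real k / (real k + 1) * 0"
      using S assms(1,3) \<open>r \<in> S\<close> diag
      by (intro coherent_coefficient_bound[where A = S and G = G and c = c])
        (auto intro!: off intro: finite_subset)
    then show "c r = 0" by simp
  qed
  then obtain c where c: "\<forall>s\<in>A. (\<Sum>r\<in>A. c r * complex_of_real (G r s)) = b s" by blast
  have cb: "norm (c r) \<le> 2 * real k / (real k + 1) * 1" if "r \<in> A" for r
    using that c b assms(1-3) diag
    by (intro coherent_coefficient_bound[where A = A and G = G and c = c]) (auto intro!: off)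
  have "norm (\<Sum>r\<in>A. c r * G r w) < 1" if w: "w \<in> W - A" for w
  proof -
    have "norm (\<Sum>r\<in>A. c r * G r w) \<le> (\<Sum>r\<in>A. 2 * real k / (real k + 1) * (1 / (2 * real k)))"
    proof (rule sum_norm_le)
      fix r assume r: "r \<in> A"
      then have "\<bar>G r w\<bar> \<le> 1 / (2 * real k)"
        using off[of r w] w assms(3) by auto
      then have "norm (c r) * \<bar>G r w\<bar> \<le> 2 * real k / (real k + 1) * 1 * (1 / (2 * real k))"
        using cb[OF r] by (intro mult_mono) auto
      then show "norm (c r * G r w) \<le> 2 * real k / (real k + 1) * (1 / (2 * real k))"
        by (simp add: norm_mult)
    qed
    also have "\<dots> = real (card A) * (2 * real k / (real k + 1) * (1 / (2 * real k)))"
      by simp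
    also have "\<dots> \<le> real k * (2 * real k / (real k + 1) * (1 / (2 * real k)))"
      using assms(2) by (intro mult_right_mono) auto
    also have "\<dots> < 1"
      by (cases "k = 0") (simp_all add: field_simps)
    finally show ?thesis .
  qed
  with c that show thesis by blast
qed

section \<open>Counting transversals\<close>

lemma card_supersets:
  assumes "finite I" "e \<subseteq> I" "card e \<le> k"
  shows "card {S. e \<subseteq> S \<and> S \<subseteq> I \<and> card S = k} = (card I - card e) choose (k - card e)"
proof -
  have fe: "finite e" using assms finite_subset by blast
  have "bij_betw (\<lambda>S. S - e) {S. e \<subseteq> S \<and> S \<subseteq> I \<and> card S = k} {T. T \<subseteq> I - e \<and> card T = k - card e}"
  proof (rule bij_betwI[where g = "\<lambda>T. T \<union> e"])
    show "(\<lambda>T. T \<union> e) \<in> {T. T \<subseteq> I - e \<and> card T = k - card e} \<rightarrow> {S. e \<subseteq> S \<and> S \<subseteq> I \<and> card S = k}"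
    proof
      fix T assume "T \<in> {T. T \<subseteq> I - e \<and> card T = k - card e}"
      then have T: "T \<subseteq> I - e" "card T = k - card e" by auto
      then have "card (T \<union> e) = card T + card e"
        using assms fe by (intro card_Un_disjoint) (auto intro: finite_subset)
      then show "T \<union> e \<in> {S. e \<subseteq> S \<and> S \<subseteq> I \<and> card S = k}"
        using T assms by auto
    qed
  qed (auto simp: card_Diff_subset fe)
  then have "card {S. e \<subseteq> S \<and> S \<subseteq> I \<and> card S = k} = card {T. T \<subseteq> I - e \<and> card T = k - card e}"
    by (rule bij_betw_same_card)
  also have "\<dots> = (card I - card e) choose (k - card e)"
    using n_subsets[of "I - e"] assms fe by (simp add: card_Diff_subset)
  finally show ?thesis .
qed

text \<open>A union bound: a set on which \<open>fst\<close> is not injective contains a pair over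
  some \<open>w\<close>, and the factors count \<open>w\<close>, the pair, and the other
  \<open>k - 2\<close> points.\<close>

lemma card_non_transversals_le:
  assumes "finite W" "finite U" "k \<ge> 2"
  shows "card {S. S \<subseteq> W \<times> U \<and> card S = k \<and> \<not> inj_on fst S}
    \<le> card W * (card U choose 2) * ((card W * card U - 2) choose (k - 2))"
proof -
  let ?E = "\<lambda>w. {e. e \<subseteq> {w} \<times> U \<and> card e = 2}"
  let ?F = "\<lambda>e. {S. e \<subseteq> S \<and> S \<subseteq> W \<times> U \<and> card S = k}"
  have fin: "finite (?E w)" for w
    using assms(2) by (auto intro: finite_subset[of _ "Pow ({w} \<times> U)"])
  have cE: "card (?E w) = card U choose 2" for w
    using n_subsets[of "{w} \<times> U" 2] assms(2) by (simp add: card_cartesian_product)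
  have cF: "card (?F e) = (card W * card U - 2) choose (k - 2)" if "w \<in> W" "e \<in> ?E w" for w e
    using card_supersets[of "W \<times> U" e k] that assms by (auto simp: card_cartesian_product)
  have "{S. S \<subseteq> W \<times> U \<and> card S = k \<and> \<not> inj_on fst S} \<subseteq> (\<Union>w\<in>W. \<Union>e\<in>?E w. ?F e)"
  proof
    fix S assume "S \<in> {S. S \<subseteq> W \<times> U \<and> card S = k \<and> \<not> inj_on fst S}"
    then have S: "S \<subseteq> W \<times> U" "card S = k" "\<not> inj_on fst S" by auto
    then obtain w u v where wuv: "(w, u) \<in> S" "(w, v) \<in> S" "u \<noteq> v"
      unfolding inj_on_def by fastforce
    then have "w \<in> W" "{(w, u), (w, v)} \<in> ?E w" "S \<in> ?F {(w, u), (w, v)}"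
      using S by auto
    then show "S \<in> (\<Union>w\<in>W. \<Union>e\<in>?E w. ?F e)" by blast
  qed
  then have "card {S. S \<subseteq> W \<times> U \<and> card S = k \<and> \<not> inj_on fst S} \<le> card (\<Union>w\<in>W. \<Union>e\<in>?E w. ?F e)"
    using assms by (intro card_mono) (auto intro!: finite_UN_I fin finite_subset[of _ "Pow (W \<times> U)"])
  also have "\<dots> \<le> (\<Sum>w\<in>W. card (\<Union>e\<in>?E w. ?F e))"
    by (rule card_UN_le[OF assms(1)])
  also have "\<dots> \<le> (\<Sum>w\<in>W. \<Sum>e\<in>?E w. card (?F e))"
    by (intro sum_mono card_UN_le fin)
  also have "\<dots> = (\<Sum>w\<in>W. \<Sum>e\<in>?E w. (card W * card U - 2) choose (k - 2))"
    by (intro sum.cong refl cF)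
  also have "\<dots> = card W * (card U choose 2) * ((card W * card U - 2) choose (k - 2))"
    by (simp only: sum_constant cE of_nat_id mult.assoc)
  finally show ?thesis .
qed

lemma choose_minus_two:
  assumes "k \<ge> 2"
  shows "real N * (real N - 1) * real ((N - 2) choose (k - 2)) = real k * (real k - 1) * real (N choose k)"
proof (cases "N \<ge> 2")
  case True
  obtain i where i: "k = Suc (Suc i)" using assms by (metis Suc_le_D numeral_2_eq_2 Suc_le_mono)
  obtain n where n: "N = Suc (Suc n)" using True by (metis Suc_le_D numeral_2_eq_2 Suc_le_mono)
  have 1: "real (Suc (Suc i)) * real (Suc (Suc n) choose Suc (Suc i)) = real (Suc (Suc n)) * real (Suc n choose Suc i)"
    by (simp only: Suc_times_binomial flip: of_nat_mult)
  have 2: "real (Suc i) * real (Suc n choose Suc i) = real (Suc n) * real (n choose i)"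
    by (simp only: Suc_times_binomial flip: of_nat_mult)
  have "real (Suc (Suc n)) * real (Suc n) * real (n choose i) = real (Suc (Suc n)) * (real (Suc i) * real (Suc n choose Suc i))"
    unfolding 2 by (simp only: mult.assoc)
  also have "\<dots> = real (Suc i) * (real (Suc (Suc i)) * real (Suc (Suc n) choose Suc (Suc i)))"
    unfolding 1 by (simp only: mult.assoc mult.left_commute)
  finally show ?thesis
    unfolding i n by (simp add: mult_ac del: binomial_Suc_Suc)
next
  case False
  then have "N < k" "N = 0 \<or> N = 1" using assms by auto
  then show ?thesis by auto
qed

text \<open>With \<open>n = card W\<close>, \<open>s = card U\<close> and \<open>N = n * s\<close>,
  the union bound is at most \<open>k * (k - 1) / 2 * (s - 1) / (N - 1)\<close> times all
  \<open>k\<close>-sets when \<open>N > 1\<close>, and \<open>(s - 1) / (N - 1) \<le> 1 / n\<close>.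
  The resulting fraction is independent of \<open>s\<close>, so \<open>U\<close> may grow
  freely.\<close>

lemma card_transversals_ge:
  assumes "finite W" "finite U" "W \<noteq> {}" "U \<noteq> {}" "k \<ge> 2"
  shows "real (card {S. S \<subseteq> W \<times> U \<and> card S = k \<and> inj_on fst S})
    \<ge> (1 - (real k)\<^sup>2 / (2 * real (card W))) * real ((card W * card U) choose k)"
proof -
  define n s where "n = card W" and "s = card U"
  let ?N = "n * s"
  let ?good = "{S. S \<subseteq> W \<times> U \<and> card S = k \<and> inj_on fst S}"
  let ?bad = "{S. S \<subseteq> W \<times> U \<and> card S = k \<and> \<not> inj_on fst S}"
  have n: "n \<ge> 1" "s \<ge> 1" using assms by (simp_all add: n_def s_def Suc_leI card_gt_0_iff)
  have fin: "finite ?good" "finite ?bad"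
    using assms by (auto intro: finite_subset[of _ "Pow (W \<times> U)"])
  have "?N choose k = card {S. S \<subseteq> W \<times> U \<and> card S = k}"
    using n_subsets[of "W \<times> U" k] assms by (simp add: card_cartesian_product n_def s_def)
  also have "\<dots> = card (?good \<union> ?bad)"
    by (rule arg_cong[of _ _ card]) blast
  also have "\<dots> = card ?good + card ?bad"
    by (rule card_Un_disjoint) (use fin in auto)
  finally have sum: "?N choose k = card ?good + card ?bad" .
  have "2 * real n * real (card ?bad) \<le> (real k)\<^sup>2 * real (?N choose k)"
  proof (cases "?N = 1")
    case True
    then have "?N choose k = 0" using assms(5) by (intro binomial_eq_0) simp
    then have "card ?bad = 0" using sum by simp
    then show ?thesis by (metis mult_zero_right of_nat_0 of_nat_0_le_iff zero_le_mult_iff zero_le_power2)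
  next
    case False
    with n have N: "?N \<ge> 2" by (cases n; cases s) auto
    then have N': "real n * real s \<ge> 2" by (metis of_nat_le_iff of_nat_mult of_nat_numeral)
    define X where "X = real ((?N - 2) choose (k - 2))"
    have "real (card ?bad) \<le> real (n * (s choose 2) * ((?N - 2) choose (k - 2)))"
      using card_non_transversals_le[OF assms(1,2,5)] unfolding n_def s_def of_nat_le_iff .
    also have "\<dots> = real n * (real s * (real s - 1) / 2) * X"
      using n by (simp add: X_def choose_two real_of_nat_div of_nat_diff)
    finally have "2 * real (card ?bad) \<le> real n * real s * (real s - 1) * X" by simp
    then have "2 * real n * real (card ?bad) \<le> real n * real s * (real n * (real s - 1)) * X"
      by (auto dest: mult_left_mono[of _ _ "real n"] simp: algebra_simps)
    \<comment> \<open>As \<open>n \<ge> 1\<close>, \<open>n * (s - 1) \<le> n * s - 1\<close>; this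
      produces the product \<open>N * (N - 1)\<close> that \<open>choose_minus_two\<close>
      absorbs.\<close>
    also have "\<dots> \<le> real n * real s * (real n * real s - 1) * X"
      using n by (intro mult_right_mono mult_left_mono) (auto simp: X_def algebra_simps)
    also have "\<dots> = real k * (real k - 1) * real (?N choose k)"
      using choose_minus_two[OF assms(5), of ?N] by (simp add: X_def)
    also have "\<dots> \<le> (real k)\<^sup>2 * real (?N choose k)"
      by (intro mult_right_mono) (auto simp: power2_eq_square algebra_simps)
    finally show ?thesis .
  qed
  then have "real (card ?bad) \<le> (real k)\<^sup>2 / (2 * real n) * real (?N choose k)"
    using n by (simp add: field_simps)
  moreover have "real (card ?good) = real (?N choose k) - real (card ?bad)"
    unfolding sum by simp
  ultimately show ?thesis
    unfolding left_diff_distrib mult_1 n_def s_def by linarith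
qed

section \<open>Exponentially large incoherent systems\<close>

text \<open>The quotient of the two sides is nonincreasing for nonnegative arguments because
  \<open>sinh y \<le> y * cosh y\<close>; both sides are even.\<close>

lemma cosh_le_exp_half_square: "cosh x \<le> exp (x\<^sup>2 / 2)" for x :: real
proof -
  have main: "cosh x \<le> exp (x\<^sup>2 / 2)" if "x \<ge> 0" for x :: real
  proof -
    have tanh: "sinh y \<le> y * cosh y" if "y \<ge> 0" for y :: real
    proof -
      have "0 * cosh 0 - sinh 0 \<le> y * cosh y - sinh y"
        by (rule DERIV_nonneg_imp_nondecreasing[OF that])
          (auto intro!: derivative_eq_intros exI)
      then show ?thesis by simp
    qed
    have "cosh x * exp (- x\<^sup>2 / 2) \<le> cosh 0 * exp (- 0\<^sup>2 / 2)"
    proof (rule DERIV_nonpos_imp_nonincreasing[OF that])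
      fix y :: real assume "0 \<le> y" "y \<le> x"
      have "((\<lambda>x. cosh x * exp (- x\<^sup>2 / 2)) has_real_derivative
          (sinh y - y * cosh y) * exp (- y\<^sup>2 / 2)) (at y)"
        by (auto intro!: derivative_eq_intros simp: algebra_simps)
      moreover have "(sinh y - y * cosh y) * exp (- y\<^sup>2 / 2) \<le> 0"
        using tanh[OF \<open>0 \<le> y\<close>] by (simp add: mult_nonpos_nonneg)
      ultimately show "\<exists>z. ((\<lambda>x. cosh x * exp (- x\<^sup>2 / 2)) has_real_derivative z) (at y) \<and> z \<le> 0"
        by blast
    qed
    then show ?thesis by (simp add: exp_minus field_simps)
  qed
  show ?thesis
    using main[of x] main[of "-x"] by (cases "x \<ge> 0") auto
qed

text \<open>\<open>PiE\<close> pins the values outside the first \<open>m\<close> indices, which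
  makes the set finite. Inner products and tensors read only these indices.\<close>

definition sign_vectors :: "nat \<Rightarrow> (nat \<Rightarrow> real) set"
  where "sign_vectors m = PiE {..<m} (\<lambda>_. {-1, 1})"

lemma finite_sign_vectors [simp]: "finite (sign_vectors m)"
  by (auto simp: sign_vectors_def intro!: finite_PiE)

lemma card_sign_vectors: "card (sign_vectors m) = 2 ^ m"
  by (simp add: sign_vectors_def card_PiE numeral_2_eq_2)

lemma sign_vectors_square: "x \<in> sign_vectors m \<Longrightarrow> i < m \<Longrightarrow> x i * x i = 1"
  by (force simp: sign_vectors_def PiE_iff)

text \<open>Chernoff bound: the exponential moment factors over the coordinates into
  \<open>(2 * cosh \<mu>) ^ m\<close>. The parameter \<open>\<mu>\<close> itself minimises the
  exponent \<open>t\<^sup>2 / 2 - t * \<mu>\<close>.\<close>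

lemma card_sign_vectors_tail:
  assumes "\<mu> > 0" and d: "\<And>i. i < m \<Longrightarrow> d i \<in> {-1, 1::real}"
  shows "real (card {x \<in> sign_vectors m. (\<Sum>i<m. d i * x i) > \<mu> * m}) \<le> 2 ^ m * exp (- (\<mu>\<^sup>2 * m / 2))"
proof -
  let ?T = "{x \<in> sign_vectors m. (\<Sum>i<m. d i * x i) > \<mu> * m}"
  have "real (card ?T) * exp (\<mu> * (\<mu> * m)) = (\<Sum>x\<in>?T. exp (\<mu> * (\<mu> * m)))"
    by simp
  also have "\<dots> \<le> (\<Sum>x\<in>?T. exp (\<mu> * (\<Sum>i<m. d i * x i)))"
    using assms(1) by (intro sum_mono) auto
  also have "\<dots> \<le> (\<Sum>x\<in>sign_vectors m. exp (\<mu> * (\<Sum>i<m. d i * x i)))"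
    by (intro sum_mono2) auto
  also have "\<dots> = (\<Sum>x\<in>sign_vectors m. \<Prod>i<m. exp (\<mu> * (d i * x i)))"
    by (simp add: sum_distrib_left exp_sum)
  also have "\<dots> = (\<Prod>i<m. \<Sum>y\<in>{-1, 1}. exp (\<mu> * (d i * y)))"
    unfolding sign_vectors_def by (rule prod_sum_PiE[symmetric]) auto
  also have "\<dots> = (\<Prod>i<m. 2 * cosh \<mu>)"
    using d by (intro prod.cong) (force simp: cosh_field_def)+
  also have "\<dots> \<le> (\<Prod>i<m. 2 * exp (\<mu>\<^sup>2 / 2))"
    using cosh_le_exp_half_square[of \<mu>] by (intro prod_mono) auto
  also have "\<dots> = 2 ^ m * exp (\<mu>\<^sup>2 * m / 2)"
    by (simp add: power_mult_distrib mult.commute flip: exp_of_nat_mult)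
  finally have "real (card ?T) \<le> 2 ^ m * exp (\<mu>\<^sup>2 * m / 2) * exp (- (\<mu> * (\<mu> * m)))"
    by (simp add: exp_minus field_simps)
  also have "\<dots> = 2 ^ m * exp (- (\<mu>\<^sup>2 * m / 2))"
    by (simp add: power2_eq_square flip: exp_add)
  finally show ?thesis .
qed

text \<open>A code of greatest cardinality cannot be extended, so its forbidden regions
  \<open>?B c\<close> cover the whole cube; each has at most
  \<open>2 * 2 ^ m * exp (- (\<mu>\<^sup>2 * m / 2))\<close> points by two one-sided tail
  bounds.\<close>

lemma incoherent_code_exists:
  assumes "0 < \<mu>" "\<mu> < 1" "m > 0"
  obtains C where "C \<subseteq> sign_vectors m" "2 * real (card C) \<ge> exp (\<mu>\<^sup>2 * m / 2)"
    "\<And>x y. x \<in> C \<Longrightarrow> y \<in> C \<Longrightarrow> x \<noteq> y \<Longrightarrow> \<bar>\<Sum>i<m. x i * y i\<bar> \<le> \<mu> * m"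
proof -
  define P where "P C \<longleftrightarrow> C \<subseteq> sign_vectors m \<and>
    (\<forall>x\<in>C. \<forall>y\<in>C. x \<noteq> y \<longrightarrow> \<bar>\<Sum>i<m. x i * y i\<bar> \<le> \<mu> * m)" for C
  have "P {}" by (simp add: P_def)
  moreover have "\<forall>C. P C \<longrightarrow> card C < Suc (card (sign_vectors m))"
    by (simp add: P_def card_mono less_Suc_eq_le)
  ultimately have "\<exists>C. P C \<and> (\<forall>C'. P C' \<longrightarrow> card C' \<le> card C)"
    by (rule ex_has_greatest_nat)
  then obtain C where "P C" and max: "\<And>C'. P C' \<Longrightarrow> card C' \<le> card C" by blast
  then have C: "C \<subseteq> sign_vectors m"
    "\<And>x y. x \<in> C \<Longrightarrow> y \<in> C \<Longrightarrow> x \<noteq> y \<Longrightarrow> \<bar>\<Sum>i<m. x i * y i\<bar> \<le> \<mu> * m"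
    by (auto simp: P_def)
  have fC: "finite C" by (rule finite_subset[OF C(1)]) simp
  let ?B = "\<lambda>c. {x \<in> sign_vectors m. \<bar>\<Sum>i<m. c i * x i\<bar> > \<mu> * m}"
  have "sign_vectors m \<subseteq> (\<Union>c\<in>C. ?B c)"
  proof (rule ccontr)
    assume "\<not> sign_vectors m \<subseteq> (\<Union>c\<in>C. ?B c)"
    then obtain x where x: "x \<in> sign_vectors m" "\<And>c. c \<in> C \<Longrightarrow> \<bar>\<Sum>i<m. c i * x i\<bar> \<le> \<mu> * m"
      by force
    have "(\<Sum>i<m. x i * x i) = m"
      using sign_vectors_square[OF x(1)] by simp
    \<comment> \<open>A code word lies in its own region, its square length \<open>m\<close>
      exceeding the threshold. Hence an uncovered \<open>x\<close> is new and enlarges the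
      code.\<close>
    moreover have "\<mu> * m < m" using assms by simp
    ultimately have "x \<notin> C" using x(2)[of x] by auto
    moreover have "P (insert x C)"
      using C x by (auto simp: P_def mult.commute)
    ultimately show False using max[of "insert x C"] fC by simp
  qed
  then have "card (sign_vectors m) \<le> card (\<Union>c\<in>C. ?B c)"
    by (intro card_mono) (auto simp: fC)
  also have "\<dots> \<le> (\<Sum>c\<in>C. card (?B c))" by (rule card_UN_le[OF fC])
  finally have "real (2 ^ m) \<le> real (\<Sum>c\<in>C. card (?B c))"
    unfolding card_sign_vectors of_nat_le_iff .
  then have "2 ^ m \<le> (\<Sum>c\<in>C. real (card (?B c)))"
    by (simp only: of_nat_sum of_nat_power of_nat_numeral)
  also have "\<dots> \<le> (\<Sum>c\<in>C. 2 * (2 ^ m * exp (- (\<mu>\<^sup>2 * m / 2))))"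
  proof (rule sum_mono)
    fix c assume "c \<in> C"
    then have c: "c i \<in> {-1, 1}" if "i < m" for i
      using C that by (auto simp: sign_vectors_def PiE_iff)
    let ?D = "\<lambda>d. {x \<in> sign_vectors m. (\<Sum>i<m. d i * x i) > \<mu> * m}"
    have "?B c \<subseteq> ?D c \<union> ?D (\<lambda>i. - c i)"
      by (auto simp: sum_negf)
    then have "card (?B c) \<le> card (?D c \<union> ?D (\<lambda>i. - c i))"
      by (intro card_mono) auto
    also have "\<dots> \<le> card (?D c) + card (?D (\<lambda>i. - c i))"
      by (rule card_Un_le)
    finally have "real (card (?B c)) \<le> real (card (?D c)) + real (card (?D (\<lambda>i. - c i)))"
      by linarith
    moreover have "real (card (?D c)) \<le> 2 ^ m * exp (- (\<mu>\<^sup>2 * m / 2))"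
      by (rule card_sign_vectors_tail[OF assms(1) c])
    moreover have "real (card (?D (\<lambda>i. - c i))) \<le> 2 ^ m * exp (- (\<mu>\<^sup>2 * m / 2))"
      by (rule card_sign_vectors_tail[OF assms(1)]) (use c in auto)
    ultimately show "real (card (?B c)) \<le> 2 * (2 ^ m * exp (- (\<mu>\<^sup>2 * m / 2)))"
      by linarith
  qed
  finally have "1 \<le> 2 * real (card C) * exp (- (\<mu>\<^sup>2 * m / 2))"
    by simp
  then have "exp (\<mu>\<^sup>2 * m / 2) \<le> 2 * real (card C)"
    by (simp add: exp_minus field_simps)
  then show thesis by (rule that[OF C(1) _ C(2)])
qed

text \<open>Adding the scaled basis vectors makes the point configuration full-dimensional.\<close>
definition scaled_basis :: "nat \<Rightarrow> (nat \<Rightarrow> real) set"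
  where "scaled_basis m = (\<lambda>a i. if i = a then sqrt m else 0) ` {..<m}"

text \<open>The code is taken with \<open>\<mu> = 1 / (2 * k)\<close>, whence the exponent. Scaled
  basis vectors are mutually orthogonal and meet code words in \<open>sqrt m\<close> up to sign;
  \<open>m \<ge> 4 * k\<^sup>2\<close> is the condition
  \<open>sqrt m \<le> \<mu> * m\<close>.\<close>

lemma incoherent_frame_exists:
  assumes "k \<ge> 1" "m \<ge> 4 * k\<^sup>2"
  obtains W where "finite W" "scaled_basis m \<subseteq> W" "2 * real (card W) \<ge> exp (m / (8 * (real k)\<^sup>2))"
    "\<And>x. x \<in> W \<Longrightarrow> (\<Sum>i<m. x i * x i) / m = 1"
    "\<And>x y. x \<in> W \<Longrightarrow> y \<in> W \<Longrightarrow> x \<noteq> y \<Longrightarrow> \<bar>(\<Sum>i<m. x i * y i) / m\<bar> \<le> 1 / (2 * real k)"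
proof -
  define \<mu> where "\<mu> = 1 / (2 * real k)"
  have \<mu>: "0 < \<mu>" "\<mu> < 1" using assms(1) by (auto simp: \<mu>_def field_simps)
  have m: "m > 0" using assms by (intro gr0I) simp
  obtain C where C: "C \<subseteq> sign_vectors m" "2 * real (card C) \<ge> exp (\<mu>\<^sup>2 * m / 2)"
    "\<And>x y. x \<in> C \<Longrightarrow> y \<in> C \<Longrightarrow> x \<noteq> y \<Longrightarrow> \<bar>\<Sum>i<m. x i * y i\<bar> \<le> \<mu> * m"
    using incoherent_code_exists[OF \<mu> m] by blast
  define e where "e a i = (if i = a then sqrt m else 0)" for a i :: nat
  have sb: "scaled_basis m = e ` {..<m}" unfolding scaled_basis_def e_def ..
  define W where "W = C \<union> scaled_basis m"
  have e1: "(\<Sum>i<m. e a i * f i) = sqrt m * f a" if "a < m" for a and f :: "nat \<Rightarrow> real"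
    using that by (simp add: e_def if_distrib[of "\<lambda>x. x * _"] cong: if_cong)
  have sq: "sqrt m \<le> \<mu> * m"
  proof -
    have "4 * (real k)\<^sup>2 \<le> real m" using assms(2) by (metis of_nat_le_iff of_nat_mult of_nat_numeral of_nat_power)
    then have "2 * real k \<le> sqrt m" by (intro real_le_rsqrt) (simp add: power_mult_distrib)
    then have "2 * real k * sqrt m \<le> sqrt m * sqrt m" by (intro mult_right_mono) auto
    then show ?thesis using assms(1) by (simp add: \<mu>_def field_simps)
  qed
  have CE: "\<bar>\<Sum>i<m. e a i * c i\<bar> \<le> \<mu> * m" if "c \<in> C" "a < m" for a c
  proof -
    have "c a \<in> {-1, 1}" using that C(1) by (auto simp: sign_vectors_def PiE_iff)
    then have "\<bar>c a\<bar> = 1" by auto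
    then show ?thesis unfolding e1[OF that(2)] using sq by (simp add: abs_mult)
  qed
  have EE: "(\<Sum>i<m. e a i * e b i) = (if a = b then m else 0)" if "a < m" for a b
    unfolding e1[OF that] by (simp add: e_def)
  have fC: "finite C" by (rule finite_subset[OF C(1)]) simp
  show thesis
  proof (rule that[of W])
    show "finite W" "scaled_basis m \<subseteq> W" using fC by (auto simp: W_def sb)
    have "card C \<le> card W" using \<open>finite W\<close> by (intro card_mono) (auto simp: W_def)
    then show "2 * real (card W) \<ge> exp (m / (8 * (real k)\<^sup>2))"
      using C(2) by (simp add: \<mu>_def power_divide power_mult_distrib mult.commute)
  next
    fix x assume "x \<in> W"
    then consider "x \<in> sign_vectors m" | a where "a < m" "x = e a"
      unfolding W_def sb using C(1) by auto
    then have "(\<Sum>i<m. x i * x i) = m"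
      by cases (simp_all add: sign_vectors_square EE)
    then show "(\<Sum>i<m. x i * x i) / m = 1" using m by simp
  next
    fix x y assume "x \<in> W" "y \<in> W" "x \<noteq> y"
    then consider "x \<in> C" "y \<in> C" | a where "a < m" "x = e a" "y \<in> C"
      | b where "b < m" "x \<in> C" "y = e b" | a b where "a < m" "b < m" "x = e a" "y = e b"
      unfolding W_def sb by auto
    then have "\<bar>\<Sum>i<m. x i * y i\<bar> \<le> \<mu> * m"
    proof cases
      case 3
      then show ?thesis using CE[of x b] by (simp add: mult.commute)
    qed (use \<open>x \<noteq> y\<close> C(3) CE EE \<mu>(1) in auto)
    then show "\<bar>(\<Sum>i<m. x i * y i) / m\<bar> \<le> 1 / (2 * real k)"
      using m by (simp add: \<mu>_def field_simps)
  qed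
qed

section \<open>The tensor polytope\<close>

lemma lookup_scaleR: "Poly_Mapping.lookup (r *\<^sub>R x) i = r *\<^sub>R Poly_Mapping.lookup x i"
  for x :: "'a \<Rightarrow>\<^sub>0 'b::real_vector"
proof -
  have "finite {i. r *\<^sub>R Poly_Mapping.lookup x i \<noteq> 0}"
    by (rule finite_subset[OF _ finite_lookup[of x]]) auto
  then show ?thesis by (simp add: scaleR_poly_mapping_def)
qed

definition coord :: "nat \<Rightarrow> nat \<Rightarrow>\<^sub>0 real"
  where "coord i = Poly_Mapping.single i 1"

lemma lookup_coord: "Poly_Mapping.lookup (coord i) j = (if i = j then 1 else 0)"
  by (simp add: coord_def lookup_single when_def)

text \<open>Coordinates \<open>2 a\<close> and \<open>2 a + 1\<close> hold the real and imaginary part of the complex coordinate \<open>a\<close>.\<close>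
definition tensor :: "nat \<Rightarrow> (nat \<Rightarrow> real) \<Rightarrow> complex \<Rightarrow> nat \<Rightarrow>\<^sub>0 real"
  where "tensor m w u = (\<Sum>a<m. w a *\<^sub>R (Re u *\<^sub>R coord (2 * a) + Im u *\<^sub>R coord (2 * a + 1)))"

lemma lookup_tensor:
  assumes "b < m"
  shows "Poly_Mapping.lookup (tensor m w u) (2 * b) = w b * Re u"
    and "Poly_Mapping.lookup (tensor m w u) (Suc (2 * b)) = w b * Im u"
proof -
  have ne: "2 * a \<noteq> Suc (2 * b)" "Suc (2 * a) \<noteq> 2 * b" for a b :: nat by presburger+
  show "Poly_Mapping.lookup (tensor m w u) (2 * b) = w b * Re u"
    "Poly_Mapping.lookup (tensor m w u) (Suc (2 * b)) = w b * Im u"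
    using assms
    by (simp_all add: tensor_def lookup_sum lookup_scaleR lookup_add lookup_coord ne
        if_distrib[of "\<lambda>x. _ * x"] cong: if_cong)
qed

lemma tensor_uminus: "tensor m w (- u) = - tensor m w u"
  by (simp add: tensor_def scaleR_add_right scaleR_diff_right flip: sum_negf)

text \<open>The real part of a Hermitian pairing is real linear:
  \<open>Re (cnj u * z) = Re u * Re z + Im u * Im z\<close>.\<close>

lemma linear_pairing:
  fixes h :: "nat \<Rightarrow> complex"
  obtains f :: "(nat \<Rightarrow>\<^sub>0 real) \<Rightarrow> real"
  where "linear f" "\<And>w u. f (tensor m w u) = Re (cnj u * (\<Sum>a<m. h a * w a))"
proof
  let ?f = "\<lambda>x. \<Sum>a<m. Re (h a) * Poly_Mapping.lookup x (2 * a) + Im (h a) * Poly_Mapping.lookup x (Suc (2 * a))"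
  show "linear ?f"
    by (rule linearI) (simp_all add: lookup_add lookup_scaleR sum.distrib sum_distrib_left algebra_simps)
  fix w u
  have "?f (tensor m w u) = (\<Sum>a<m. Re (cnj u * (h a * w a)))"
    by (rule sum.cong) (simp_all add: lookup_tensor distrib_left mult.left_commute)
  then show "?f (tensor m w u) = Re (cnj u * (\<Sum>a<m. h a * w a))"
    by (simp add: sum_distrib_left)
qed

lemma Re_cnj_mult_less_1:
  assumes "norm u = 1" "norm v = 1" "u \<noteq> v"
  shows "Re (cnj u * v) < 1"
proof -
  have "0 < (norm (u - v))\<^sup>2" using assms(3) by simp
  also have "\<dots> = (norm u)\<^sup>2 + (norm v)\<^sup>2 - 2 * Re (cnj u * v)"
    by (simp add: cmod_power2 power2_diff)
  finally show ?thesis using assms by simp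
qed

text \<open>Injectivity of \<open>fst\<close> on \<open>K\<close> makes the prescribed number
  \<open>b w\<close> a function of \<open>w\<close>, so interpolation applies. A point with
  \<open>w\<close> in \<open>A\<close> but another \<open>u\<close> stays below 1 because distinct
  unit numbers have real product below 1; for other \<open>w\<close> the modulus is already below
  1.\<close>

lemma transversal_functional:
  assumes K: "K \<subseteq> W \<times> U" "inj_on fst K" "finite K" "card K \<le> k"
    and U: "\<And>u. u \<in> U \<Longrightarrow> norm u = 1"
    and diag: "\<And>x. x \<in> W \<Longrightarrow> (\<Sum>i<m. x i * x i) / m = 1"
    and off: "\<And>x y. x \<in> W \<Longrightarrow> y \<in> W \<Longrightarrow> x \<noteq> y \<Longrightarrow> \<bar>(\<Sum>i<m. x i * y i) / m\<bar> \<le> 1 / (2 * real k)"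
  obtains f :: "(nat \<Rightarrow>\<^sub>0 real) \<Rightarrow> real" where "linear f"
    "\<And>w u. (w, u) \<in> K \<Longrightarrow> f (tensor m w u) = 1"
    "\<And>w u. (w, u) \<in> W \<times> U - K \<Longrightarrow> f (tensor m w u) < 1"
proof -
  define G where "G x y = (\<Sum>i<m. x i * y i) / m" for x y :: "nat \<Rightarrow> real"
  define A where "A = fst ` K"
  define b where "b w = snd (inv_into K fst w)" for w
  have b: "b w = u" if "(w, u) \<in> K" for w u
    using inv_into_f_f[OF K(2) that] by (simp add: b_def)
  have bK: "(w, b w) \<in> K" if "w \<in> A" for w
    using that b by (auto simp: A_def)
  have A: "finite A" "card A \<le> k" "A \<subseteq> W"
    using K card_image_le[OF K(3), of fst] by (auto simp: A_def)
  have nb: "norm (b w) = 1" if "w \<in> A" for w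
    using bK[OF that] K(1) U by auto
  obtain c where c: "\<And>s. s \<in> A \<Longrightarrow> (\<Sum>r\<in>A. c r * complex_of_real (G r s)) = b s"
    "\<And>w. w \<in> W - A \<Longrightarrow> norm (\<Sum>r\<in>A. c r * complex_of_real (G r w)) < 1"
    using coherent_interpolation[OF A, of G b] diag off nb unfolding G_def by blast
  \<comment> \<open>Chosen so that pairing \<open>h\<close> with \<open>w\<close> gives the
    interpolating combination of the Gram entries \<open>G r w\<close>.\<close>
  define h where "h a = (\<Sum>r\<in>A. c r * (r a / m))" for a
  obtain f where f: "linear f" "\<And>w u. f (tensor m w u) = Re (cnj u * (\<Sum>a<m. h a * w a))"
    using linear_pairing[of m h] by blast
  have "(\<Sum>a<m. h a * w a) = (\<Sum>r\<in>A. \<Sum>a<m. c r * (r a / m) * w a)" for w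
    unfolding h_def sum_distrib_right by (rule sum.swap)
  then have hG: "(\<Sum>a<m. h a * w a) = (\<Sum>r\<in>A. c r * G r w)" for w
    by (simp add: G_def sum_divide_distrib sum_distrib_left mult.assoc)
  show thesis
  proof (rule that[OF f(1)])
    fix w u assume wu: "(w, u) \<in> K"
    then have "w \<in> A" by (force simp: A_def)
    moreover have "cnj u * u = 1"
      using U wu K(1) by (auto simp: mult.commute[of "cnj _"] complex_norm_square[symmetric])
    ultimately show "f (tensor m w u) = 1"
      unfolding f(2) hG using c(1) b[OF wu] by simp
  next
    fix w u assume wu: "(w, u) \<in> W \<times> U - K"
    then have u: "norm u = 1" using U by auto
    show "f (tensor m w u) < 1"
    proof (cases "w \<in> A")
      case True
      then have "u \<noteq> b w" using bK wu by auto
      then show ?thesis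
        unfolding f(2) hG c(1)[OF True] using u nb[OF True] by (intro Re_cnj_mult_less_1)
    next
      case False
      have "Re (cnj u * (\<Sum>r\<in>A. c r * G r w)) \<le> norm (cnj u * (\<Sum>r\<in>A. c r * G r w))"
        by (rule complex_Re_le_cmod)
      also have "\<dots> < 1" using c(2)[of w] False wu u by (simp add: norm_mult)
      finally show ?thesis unfolding f(2) hG .
    qed
  qed
qed

section \<open>Dimension of the point configuration\<close>

lemma independent_coord: "independent (coord ` I)"
  unfolding dependent_def
proof
  assume "\<exists>a\<in>coord ` I. a \<in> span (coord ` I - {a})"
  then obtain i where i: "coord i \<in> span (coord ` I - {coord i})" by blast
  have "span (coord ` I - {coord i}) \<subseteq> {x. Poly_Mapping.lookup x i = 0}"
  proof (rule span_minimal)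
    show "subspace {x::nat \<Rightarrow>\<^sub>0 real. Poly_Mapping.lookup x i = 0}"
      by (rule subspaceI) (simp_all add: lookup_add lookup_scaleR)
  qed (auto simp: lookup_coord)
  with i show False by (auto simp: lookup_coord)
qed

lemma inj_coord: "inj coord"
  by (rule injI) (metis lookup_coord zero_neq_one)

text \<open>Tensoring a scaled basis vector with 1 and \<open>\<i>\<close> gives
  \<open>sqrt m\<close> times the two coordinate vectors of that index.\<close>

lemma span_tensors:
  assumes "m > 0" "scaled_basis m \<subseteq> W" "1 \<in> U" "\<i> \<in> U"
  shows "span (case_prod (tensor m) ` (W \<times> U)) = span (coord ` {..<2 * m})"
    (is "span ?X = span ?E")
proof
  have "tensor m w u \<in> span ?E" for w u
    unfolding tensor_def
    by (intro span_sum span_scale span_add) (auto intro: span_base)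
  then show "span ?X \<subseteq> span ?E"
    by (intro span_minimal subspace_span) auto
  have "coord i \<in> span ?X" if "i < 2 * m" for i
  proof -
    define a where "a = i div 2"
    have a: "a < m" "i = 2 * a \<or> i = Suc (2 * a)" using that by (auto simp: a_def)
    define w where "w = (\<lambda>j. if j = a then sqrt m else 0)"
    have "w \<in> W" using a(1) assms(2) unfolding w_def scaled_basis_def by blast
    then have X: "tensor m w 1 \<in> span ?X" "tensor m w \<i> \<in> span ?X"
      using assms by (auto intro!: span_base)
    have "tensor m w u = sqrt m *\<^sub>R (Re u *\<^sub>R coord (2 * a) + Im u *\<^sub>R coord (2 * a + 1))" for u
      using a(1) unfolding tensor_def w_def
      by (simp add: if_distrib[of "\<lambda>x. x *\<^sub>R _"] cong: if_cong)
    then have "coord (2 * a) = (1 / sqrt m) *\<^sub>R tensor m w 1"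
      "coord (Suc (2 * a)) = (1 / sqrt m) *\<^sub>R tensor m w \<i>"
      using assms(1) by simp_all
    then show ?thesis using a(2) X by (metis span_scale)
  qed
  then show "span ?E \<subseteq> span ?X"
    by (intro span_minimal subspace_span) auto
qed

text \<open>With 0 in the hull, the affine hull is the linear span; 0 and the \<open>n\<close>
  coordinate vectors form an affine basis of \<open>n + 1\<close> points.\<close>

lemma affine_dim_convex_hull_spanning:
  fixes X :: "(nat \<Rightarrow>\<^sub>0 real) set"
  assumes "0 \<in> convex hull X" "span X = span (coord ` {..<n})"
  shows "affine_dim (convex hull X) = int n"
proof -
  let ?E = "coord ` {..<n}"
  have E0: "0 \<notin> ?E" by (metis (no_types) dependent_zero independent_coord)
  have "affine hull insert 0 ?E = span ?E"
    by (simp add: affine_hull_span_0 hull_inc)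
  moreover have "affine hull (convex hull X) = span X"
    using assms(1) convex_hull_subset_affine_hull by (auto intro!: affine_hull_span_0)
  moreover have "\<not> affine_dependent (insert 0 ?E)"
    using affine_dependent_iff_dependent[OF E0] independent_coord by (simp add: image_image)
  ultimately have "affine_dim (convex hull X) = int (card (insert 0 ?E)) - 1"
    using assms(2) by (intro affine_dim_eqI) auto
  then show ?thesis
    using E0 card_image[OF inj_on_subset[OF inj_coord], of "{..<n}"] by simp
qed

lemma tensor_polytope:
  assumes "m > 0" "k \<ge> 2" "finite W" and basis: "scaled_basis m \<subseteq> W"
    and diag: "\<And>x. x \<in> W \<Longrightarrow> (\<Sum>i<m. x i * x i) / m = 1"
    and off: "\<And>x y. x \<in> W \<Longrightarrow> y \<in> W \<Longrightarrow> x \<noteq> y \<Longrightarrow> \<bar>(\<Sum>i<m. x i * y i) / m\<bar> \<le> 1 / (2 * real k)"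
    and U: "finite U" "\<And>u. u \<in> U \<Longrightarrow> norm u = 1" "\<And>u. u \<in> U \<Longrightarrow> - u \<in> U" "1 \<in> U" "\<i> \<in> U"
  defines "P \<equiv> convex hull (case_prod (tensor m) ` (W \<times> U))"
  shows "polytope P" "centrally_symmetric P" "affine_dim P = int (2 * m)"
    "card (vertices P) = card W * card U"
    "card {S. S \<subseteq> W \<times> U \<and> card S = k \<and> inj_on fst S} \<le> card (faces_of_dim (int k - 1) P)"
proof -
  let ?t = "case_prod (tensor m)"
  define X where "X = ?t ` (W \<times> U)"
  have P: "P = convex hull X" by (simp add: P_def X_def)
  have fX: "finite X" using assms by (simp add: X_def)
  have fWU: "finite (W \<times> U)" using assms by simp
  have func: "\<exists>f::(nat \<Rightarrow>\<^sub>0 real) \<Rightarrow> real. linear f \<and> (\<forall>p\<in>K. f (?t p) = 1) \<and> (\<forall>p\<in>W \<times> U - K. f (?t p) < 1)"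
    if K: "K \<subseteq> W \<times> U" "inj_on fst K" "card K \<le> k" for K
  proof -
    have "finite K" using K(1) fWU finite_subset by blast
    then obtain f :: "(nat \<Rightarrow>\<^sub>0 real) \<Rightarrow> real" where "linear f"
      "\<And>w u. (w, u) \<in> K \<Longrightarrow> f (tensor m w u) = 1"
      "\<And>w u. (w, u) \<in> W \<times> U - K \<Longrightarrow> f (tensor m w u) < 1"
      using transversal_functional[OF K(1,2) _ K(3) U(2) diag off] by blast
    then show ?thesis by (intro exI[of _ f]) auto
  qed
  have sup: "supported X (?t ` K)" if "K \<subseteq> W \<times> U" "inj_on fst K" "card K \<le> k" for K
    using func[OF that] unfolding supported_def X_def by (elim ex_forward) blast
  \<comment> \<open>The functional for the singleton \<open>{p}\<close> already separates
    \<open>?t p\<close> from the image of every other pair.\<close>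
  have inj: "inj_on ?t (W \<times> U)"
  proof (rule inj_onI, rule ccontr)
    fix p q assume pq: "p \<in> W \<times> U" "q \<in> W \<times> U" "?t p = ?t q" "p \<noteq> q"
    obtain f :: "(nat \<Rightarrow>\<^sub>0 real) \<Rightarrow> real" where "\<forall>p\<in>{p}. f (?t p) = 1" "\<forall>p'\<in>W \<times> U - {p}. f (?t p') < 1"
      using func[of "{p}"] pq(1) assms(2) by auto
    then have "f (?t p) = 1" "f (?t q) < 1" using pq(2,4) by blast+
    then show False unfolding pq(3) by simp
  qed
  show "polytope P" unfolding P polytope_def using fX by blast
  have "uminus ` X = X"
  proof -
    have "- x \<in> X" if "x \<in> X" for x
    proof -
      obtain w u where wu: "w \<in> W" "u \<in> U" "x = tensor m w u"
        using \<open>x \<in> X\<close> by (auto simp: X_def)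
      then have "- x = ?t (w, - u)" "(w, - u) \<in> W \<times> U"
        using U(3) by (auto simp: tensor_uminus)
      then show ?thesis unfolding X_def by blast
    qed
    then show ?thesis by force
  qed
  then show "centrally_symmetric P"
    unfolding centrally_symmetric_def P
    by (simp add: convex_hull_linear_image linear_uminus)
  have "scaled_basis m \<noteq> {}" using assms(1) by (auto simp: scaled_basis_def)
  then obtain w where "w \<in> W" using basis by blast
  then have "?t (w, 1) \<in> X" "?t (w, - 1) \<in> X"
    using U(3)[OF U(4)] U(4) unfolding X_def by blast+
  then have "tensor m w 1 \<in> X" "- tensor m w 1 \<in> X"
    by (simp_all add: tensor_uminus)
  \<comment> \<open>The midpoint of two antipodal points puts 0 into the hull.\<close>
  then have "(1/2) *\<^sub>R tensor m w 1 + (1/2) *\<^sub>R (- tensor m w 1) \<in> convex hull X"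
    by (intro convexD convex_convex_hull hull_inc) auto
  then have "0 \<in> convex hull X" by simp
  then show "affine_dim P = int (2 * m)"
    unfolding P using span_tensors[OF assms(1) basis U(4,5)]
    by (intro affine_dim_convex_hull_spanning) (auto simp: X_def)
  have "supported X {x}" if "x \<in> X" for x
  proof -
    obtain p where "p \<in> W \<times> U" "x = ?t p" using \<open>x \<in> X\<close> unfolding X_def by blast
    then show ?thesis using sup[of "{p}"] assms(2) by simp
  qed
  then have "vertices P = X" unfolding P by (intro vertices_supported fX)
  then show "card (vertices P) = card W * card U"
    unfolding X_def using inj by (simp add: card_image card_cartesian_product)
  let ?good = "{S. S \<subseteq> W \<times> U \<and> card S = k \<and> inj_on fst S}"
  have "inj_on ((`) ?t) ?good"
    by (rule inj_on_subset[OF inj_on_image_Pow[OF inj]]) auto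
  then have "card ?good = card ((`) ?t ` ?good)" by (simp add: card_image)
  also have "\<dots> \<le> card (faces_of_dim (int k - 1) P)"
    unfolding P
  proof (rule card_faces_of_dim_ge[OF fX])
    fix S assume "S \<in> (`) ?t ` ?good"
    then obtain S' where S': "S = ?t ` S'" "S' \<subseteq> W \<times> U" "card S' = k" "inj_on fst S'" by blast
    then show "S \<subseteq> X \<and> card S = k"
      using inj by (auto simp: X_def card_image inj_on_subset)
    fix T assume "T \<subseteq> S"
    then obtain T' where T': "T' \<subseteq> S'" "T = ?t ` T'" unfolding S'(1) by (metis subset_imageE)
    have "finite S'" using S'(2) fWU finite_subset by blast
    then have "card T' \<le> k" using T'(1) S'(3) card_mono by blast
    then show "supported X T"
      using T' S' sup[of T'] inj_on_subset by blast
  qed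
  finally show "card ?good \<le> card (faces_of_dim (int k - 1) P)" .
qed

section \<open>Comparison of rates and choice of parameters\<close>

text \<open>In dimension \<open>2 * m\<close> the right side is
  \<open>exp (- m / k\<^sup>2 * (6 * ln 2 / (20 * 2 ^ k)))\<close>, so the claim reduces to
  \<open>48 * ln 2 \<le> 20 * 2 ^ k\<close>; already \<open>20 * 4\<close> exceeds 48.\<close>

lemma exponential_rate_le:
  assumes "k \<ge> 2"
  shows "exp (- (real m / (8 * (real k)\<^sup>2))) \<le> (2 powr (- 3 / (20 * (real k)\<^sup>2 * 2 ^ k))) ^ (2 * m)"
proof -
  have "ln 2 \<le> (1::real)" using ln_le_minus_one[of "2::real"] by simp
  moreover have "2 ^ 2 \<le> (2::real) ^ k" using assms by (intro power_increasing) auto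
  ultimately have "48 * ln 2 \<le> 20 * (2::real) ^ k" by simp
  then have "6 * ln 2 / (20 * 2 ^ k) \<le> (1 / 8 :: real)"
    by (simp add: field_simps)
  then have "real m / (real k)\<^sup>2 * (6 * ln 2 / (20 * 2 ^ k)) \<le> real m / (real k)\<^sup>2 * (1 / 8)"
    by (rule mult_left_mono) simp
  then have "- (real m / (8 * (real k)\<^sup>2)) \<le> real (2 * m) * (- 3 / (20 * (real k)\<^sup>2 * 2 ^ k) * ln 2)"
    by (simp add: field_simps)
  then show ?thesis
    unfolding powr_def by (simp flip: exp_of_nat_mult)
qed

text \<open>An order divisible by 4 puts \<open>\<i>\<close> into \<open>U\<close>, as spanning
  requires, and makes \<open>U\<close> closed under negation, as central symmetry requires.\<close>

lemma roots_of_unity_symmetric: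
  assumes "j > 0"
  defines "U \<equiv> {z::complex. z ^ (4 * j) = 1}"
  shows "finite U" "card U = 4 * j" "\<And>u. u \<in> U \<Longrightarrow> norm u = 1" "\<And>u. u \<in> U \<Longrightarrow> - u \<in> U" "1 \<in> U" "\<i> \<in> U"
proof -
  show c: "card U = 4 * j"
    unfolding U_def using assms(1) by (intro card_roots_unity_eq) auto
  show "finite U" by (rule card_ge_0_finite) (use c assms(1) in simp)
  show "norm u = 1" if "u \<in> U" for u
  proof -
    have "norm u ^ (4 * j) = 1" using that by (simp add: U_def flip: norm_power)
    then show ?thesis
      using assms(1) power_eq_iff_eq_base[of "4 * j" "norm u" 1] by simp
  qed
qed (auto simp: U_def power_mult power_minus_even)

theorem corollary5p4:
  fixes k :: nat
  assumes "k \<ge> 2"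
  shows "\<forall>d0::nat. \<exists>d\<ge>d0. \<forall>N0::nat. \<exists>N\<ge>N0. \<exists>P :: (nat \<Rightarrow>\<^sub>0 real) set.
    polytope P \<and> centrally_symmetric P \<and> affine_dim P = int d \<and> card (vertices P) = N \<and>
    real (card (faces_of_dim (int k - 1) P)) \<ge>
      (1 - (real k)\<^sup>2 * (2 powr (- 3 / (20 * (real k)\<^sup>2 * 2 ^ k))) ^ d) * real (N choose k)"
proof (intro allI)
  fix d0 :: nat
  \<comment> \<open>Large enough both for \<open>2 * m \<ge> d0\<close> and for the incoherent
    frame.\<close>
  define m where "m = d0 + 4 * k\<^sup>2"
  have m: "m > 0" "m \<ge> 4 * k\<^sup>2" "2 * m \<ge> d0" using assms by (auto simp: m_def)
  let ?q = "(2 powr (- 3 / (20 * (real k)\<^sup>2 * 2 ^ k))) ^ (2 * m)"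
  have k1: "k \<ge> 1" using assms by simp
  obtain W where W: "finite W" "scaled_basis m \<subseteq> W"
    and card_W: "2 * real (card W) \<ge> exp (m / (8 * (real k)\<^sup>2))"
    and gram: "\<And>x. x \<in> W \<Longrightarrow> (\<Sum>i<m. x i * x i) / m = 1"
    "\<And>x y. x \<in> W \<Longrightarrow> y \<in> W \<Longrightarrow> x \<noteq> y \<Longrightarrow> \<bar>(\<Sum>i<m. x i * y i) / m\<bar> \<le> 1 / (2 * real k)"
    using incoherent_frame_exists[OF k1 m(2)] by blast
  have W1: "card W > 0" using card_W exp_gt_zero[of "m / (8 * (real k)\<^sup>2)"] by (intro gr0I) simp
  have "1 / (2 * real (card W)) \<le> 1 / exp (m / (8 * (real k)\<^sup>2))"
    by (rule divide_left_mono) (use card_W W1 in auto)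
  also have "\<dots> \<le> ?q"
    using exponential_rate_le[OF assms, of m] by (simp add: exp_minus field_simps)
  finally have "1 / (2 * real (card W)) \<le> ?q" .
  then have rate: "(real k)\<^sup>2 / (2 * real (card W)) \<le> (real k)\<^sup>2 * ?q"
    using mult_left_mono[of "1 / (2 * real (card W))" ?q "(real k)\<^sup>2"] by simp
  show "\<exists>d\<ge>d0. \<forall>N0::nat. \<exists>N\<ge>N0. \<exists>P :: (nat \<Rightarrow>\<^sub>0 real) set.
    polytope P \<and> centrally_symmetric P \<and> affine_dim P = int d \<and> card (vertices P) = N \<and>
    real (card (faces_of_dim (int k - 1) P)) \<ge>
      (1 - (real k)\<^sup>2 * (2 powr (- 3 / (20 * (real k)\<^sup>2 * 2 ^ k))) ^ d) * real (N choose k)"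
  proof (rule exI[of _ "2 * m"], intro conjI m(3) allI)
    fix N0 :: nat
    \<comment> \<open>Only \<open>U\<close> depends on \<open>N0\<close>: the frame
      \<open>W\<close>, and with it dimension and rate, is fixed while the number of vertices
      grows.\<close>
    define U where "U = {z::complex. z ^ (4 * Suc N0) = 1}"
    note U = roots_of_unity_symmetric[of "Suc N0", OF zero_less_Suc, folded U_def]
    define P where "P = convex hull (case_prod (tensor m) ` (W \<times> U))"
    note P = tensor_polytope[OF m(1) assms W gram U(1,3-6), folded P_def]
    let ?N = "card W * card U"
    have "?N \<ge> N0" using W1 U(2) by (cases "card W") auto
    have "(1 - (real k)\<^sup>2 * ?q) * real (?N choose k) \<le> (1 - (real k)\<^sup>2 / (2 * real (card W))) * real (?N choose k)"
      using rate by (intro mult_right_mono) auto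
    also have "\<dots> \<le> real (card {S. S \<subseteq> W \<times> U \<and> card S = k \<and> inj_on fst S})"
      using W1 U by (intro card_transversals_ge W(1) assms) auto
    also have "\<dots> \<le> real (card (faces_of_dim (int k - 1) P))"
      by (rule of_nat_mono[OF P(5)])
    finally have "(1 - (real k)\<^sup>2 * ?q) * real (?N choose k) \<le> real (card (faces_of_dim (int k - 1) P))" .
    then show "\<exists>N\<ge>N0. \<exists>P :: (nat \<Rightarrow>\<^sub>0 real) set.
      polytope P \<and> centrally_symmetric P \<and> affine_dim P = int (2 * m) \<and> card (vertices P) = N \<and>
      real (card (faces_of_dim (int k - 1) P)) \<ge> (1 - (real k)\<^sup>2 * ?q) * real (N choose k)"
      using P(1-4) \<open>?N \<ge> N0\<close> by (intro exI[of _ ?N] exI[of _ P] conjI)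
  qed
qed

end
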